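(* There is a strict 2-category ${\tt 2Lei_\infty}\text{-}{\tt Alg}$ whose objects are the 2-term Leibniz infinity algebras, whose 1-morphisms are the infinity morphisms between them, and whose 2-morphisms $f\Rightarrow g$ are the 2-term $\infty$-homotopies from $f$ to $g$, with vertical composition $\tau_1\circ_1\theta_1=\tau_1+\theta_1$ (for $\theta_1:f\Rightarrow g$, $\tau_1:g\Rightarrow h$), with horizontal composition $\tau_1\circ_0\theta_1=g_1'\theta_1+\tau_1f_1=f_1'\theta_1+\tau_1g_1$ (for $\theta_1:f\Rightarrow g$ with $f,g:V\to W$ and $\tau_1:f'\Rightarrow g'$ with $f',g':W\to X$), and with the zero map as identity 2-morphism of each 1-morphism.
   Context: $\mathbb K$ is a field of characteristic $0$; everything is graded homologically. **2-term Leibniz infinity algebra.** A graded vector space $V=V_0\oplus V_1$ with linear, bilinear, trilinear maps $l_1,l_2,l_3$ on $V$ of degrees $-1,0,1$ such that, for $w,x,y,z\in V_0$, $h,k\in V_1$: (a) $l_1l_2(x,h)=l_2(x,l_1h)$, $l_1l_2(h,x)=l_2(l_1h,x)$; (b) $l_2(l_1h,k)=l_2(h,l_1k)$; (c) $l_1l_3(x,y,z)=l_2(x,l_2(y,z))-l_2(y,l_2(x,z))-l_2(l_2(x,y),z)$; (d) $l_3(x,y,l_1h)=l_2(x,l_2(y,h))-l_2(y,l_2(x,h))-l_2(l_2(x,y),h)$, $l_3(x,l_1h,y)=l_2(x,l_2(h,y))-l_2(h,l_2(x,y))-l_2(l_2(x,h),y)$, $l_3(l_1h,x,y)=l_2(h,l_2(x,y))-l_2(x,l_2(h,y))-l_2(l_2(h,x),y)$;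 (e) $l_2(l_3(w,x,y),z)+l_2(w,l_3(x,y,z))-l_2(x,l_3(w,y,z))+l_2(y,l_3(w,x,z))-l_3(l_2(w,x),y,z)+l_3(w,l_2(x,y),z)-l_3(x,l_2(w,y),z)-l_3(w,x,l_2(y,z))+l_3(w,y,l_2(x,z))-l_3(x,y,l_2(w,z))=0$. **Infinity morphism** $f=(f_1,f_2):(V,l_i)\to(W,m_i)$: a linear map $f_1:V\to W$ of degree $0$ and a bilinear map $f_2:V\times V\to W$ of degree $1$ such that, for $x,y,z\in V_0$, $h\in V_1$: (a) $m_1f_1h=f_1l_1h$; (b) $m_2(f_1x,f_1y)+m_1f_2(x,y)=f_1l_2(x,y)$; (c) $m_2(f_1x,f_1h)=f_1l_2(x,h)-f_2(x,l_1h)$, $m_2(f_1h,f_1x)=f_1l_2(h,x)-f_2(l_1h,x)$; (d) $m_3(f_1x,f_1y,f_1z)-m_2(f_2(x,y),f_1z)+m_2(f_1x,f_2(y,z))-m_2(f_1y,f_2(x,z))=f_1l_3(x,y,z)+f_2(l_2(x,y),z)-f_2(x,l_2(y,z))+f_2(y,l_2(x,z))$. Composition of infinity morphisms $f:V\to W$, $g:W\to X$: $(g\circ f)_1=g_1f_1$, $(g\circ f)_2(x,y)=g_2(f_1x,f_1y)+g_1f_2(x,y)$; identity $(\mathrm{id},0)$. **2-term $\infty$-homotopy** $\theta_1:f\Rightarrow g$ between infinity morphisms $f,g:V\to W$: a linear map $\theta_1:V\to W$ of degree $1$ such that, for $x,y\in V_0$, $h\in V_1$: (a) $g_1x-f_1x=m_1\theta_1x$;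 (b) $g_1h-f_1h=\theta_1l_1h$; (c) $g_2(x,y)-f_2(x,y)=\theta_1l_2(x,y)-m_2(f_1x,\theta_1y)-m_2(\theta_1x,g_1y)$. *)

theory Defs
  imports "HOL-Algebra.AbelCoset" "HOL-Algebra.Module"
begin

section \<open>Strict 2-categories\<close>

text \<open>
  Hom-sets are given as families indexed by source and target, and all operations take the
  sources and targets of their arguments as parameters; hom-sets for different indices may overlap.
  Compositions are written in the usual applicative order: \<open>Comp A B C g f\<close> is \<open>g\<close> after \<open>f\<close>.
\<close>

locale category =
  fixes Ob :: "'o set"
    and Hom :: "'o \<Rightarrow> 'o \<Rightarrow> 'm set"
    and Id :: "'o \<Rightarrow> 'm"
    and Comp :: "'o \<Rightarrow> 'o \<Rightarrow> 'o \<Rightarrow> 'm \<Rightarrow> 'm \<Rightarrow> 'm"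
  assumes Id_in: "A \<in> Ob \<Longrightarrow> Id A \<in> Hom A A"
    and Comp_in: "\<lbrakk>A \<in> Ob; B \<in> Ob; C \<in> Ob; f \<in> Hom A B; g \<in> Hom B C\<rbrakk>
      \<Longrightarrow> Comp A B C g f \<in> Hom A C"
    and Comp_Id_left: "\<lbrakk>A \<in> Ob; B \<in> Ob; f \<in> Hom A B\<rbrakk> \<Longrightarrow> Comp A B B (Id B) f = f"
    and Comp_Id_right: "\<lbrakk>A \<in> Ob; B \<in> Ob; f \<in> Hom A B\<rbrakk> \<Longrightarrow> Comp A A B f (Id A) = f"
    and Comp_assoc: "\<lbrakk>A \<in> Ob; B \<in> Ob; C \<in> Ob; D \<in> Ob; f \<in> Hom A B; g \<in> Hom B C; h \<in> Hom C D\<rbrakk>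
      \<Longrightarrow> Comp A C D h (Comp A B C g f) = Comp A B D (Comp B C D h g) f"

text \<open>
  A strict 2-category is a category enriched in categories.  \<open>Cell A B f g\<close> is the set of
  2-morphisms \<open>f \<Rightarrow> g\<close> for \<open>f, g : A \<rightarrow> B\<close>.  \<open>VComp A B f g h \<tau> \<theta>\<close> is the vertical composite of
  \<open>\<theta> : f \<Rightarrow> g\<close> and \<open>\<tau> : g \<Rightarrow> h\<close>, and \<open>HComp A B C f g f' g' \<tau> \<theta>\<close> is the horizontal composite of
  \<open>\<theta> : f \<Rightarrow> g\<close> (between morphisms \<open>A \<rightarrow> B\<close>) and \<open>\<tau> : f' \<Rightarrow> g'\<close> (between morphisms \<open>B \<rightarrow> C\<close>).
\<close>

locale strict_two_category = category Ob Hom Id Comp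
  for Ob :: "'o set"
    and Hom :: "'o \<Rightarrow> 'o \<Rightarrow> 'm set"
    and Id :: "'o \<Rightarrow> 'm"
    and Comp :: "'o \<Rightarrow> 'o \<Rightarrow> 'o \<Rightarrow> 'm \<Rightarrow> 'm \<Rightarrow> 'm" +
  fixes Cell :: "'o \<Rightarrow> 'o \<Rightarrow> 'm \<Rightarrow> 'm \<Rightarrow> 'c set"
    and Id2 :: "'o \<Rightarrow> 'o \<Rightarrow> 'm \<Rightarrow> 'c"
    and VComp :: "'o \<Rightarrow> 'o \<Rightarrow> 'm \<Rightarrow> 'm \<Rightarrow> 'm \<Rightarrow> 'c \<Rightarrow> 'c \<Rightarrow> 'c"
    and HComp :: "'o \<Rightarrow> 'o \<Rightarrow> 'o \<Rightarrow> 'm \<Rightarrow> 'm \<Rightarrow> 'm \<Rightarrow> 'm \<Rightarrow> 'c \<Rightarrow> 'c \<Rightarrow> 'c"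
  assumes Hom_category:
      "\<lbrakk>A \<in> Ob; B \<in> Ob\<rbrakk> \<Longrightarrow> category (Hom A B) (Cell A B) (Id2 A B) (VComp A B)"
    and HComp_in:
      "\<lbrakk>A \<in> Ob; B \<in> Ob; C \<in> Ob; f \<in> Hom A B; g \<in> Hom A B; f' \<in> Hom B C; g' \<in> Hom B C;
        \<theta> \<in> Cell A B f g; \<tau> \<in> Cell B C f' g'\<rbrakk>
      \<Longrightarrow> HComp A B C f g f' g' \<tau> \<theta> \<in> Cell A C (Comp A B C f' f) (Comp A B C g' g)"
    and HComp_Id2:
      "\<lbrakk>A \<in> Ob; B \<in> Ob; C \<in> Ob; f \<in> Hom A B; f' \<in> Hom B C\<rbrakk>
      \<Longrightarrow> HComp A B C f f f' f' (Id2 B C f') (Id2 A B f) = Id2 A C (Comp A B C f' f)"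
    and interchange:
      "\<lbrakk>A \<in> Ob; B \<in> Ob; C \<in> Ob;
        f \<in> Hom A B; g \<in> Hom A B; h \<in> Hom A B; f' \<in> Hom B C; g' \<in> Hom B C; h' \<in> Hom B C;
        \<theta> \<in> Cell A B f g; \<theta>' \<in> Cell A B g h; \<tau> \<in> Cell B C f' g'; \<tau>' \<in> Cell B C g' h'\<rbrakk>
      \<Longrightarrow> HComp A B C f h f' h' (VComp B C f' g' h' \<tau>' \<tau>) (VComp A B f g h \<theta>' \<theta>) =
          VComp A C (Comp A B C f' f) (Comp A B C g' g) (Comp A B C h' h)
            (HComp A B C g h g' h' \<tau>' \<theta>') (HComp A B C f g f' g' \<tau> \<theta>)"
    and HComp_unit_left:
      "\<lbrakk>A \<in> Ob; B \<in> Ob; f \<in> Hom A B; g \<in> Hom A B; \<theta> \<in> Cell A B f g\<rbrakk>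
      \<Longrightarrow> HComp A B B f g (Id B) (Id B) (Id2 B B (Id B)) \<theta> = \<theta>"
    and HComp_unit_right:
      "\<lbrakk>A \<in> Ob; B \<in> Ob; f \<in> Hom A B; g \<in> Hom A B; \<theta> \<in> Cell A B f g\<rbrakk>
      \<Longrightarrow> HComp A A B (Id A) (Id A) f g \<theta> (Id2 A A (Id A)) = \<theta>"
    and HComp_assoc:
      "\<lbrakk>A \<in> Ob; B \<in> Ob; C \<in> Ob; D \<in> Ob; f \<in> Hom A B; g \<in> Hom A B;
        f' \<in> Hom B C; g' \<in> Hom B C; f'' \<in> Hom C D; g'' \<in> Hom C D;
        \<theta> \<in> Cell A B f g; \<tau> \<in> Cell B C f' g'; \<omega> \<in> Cell C D f'' g''\<rbrakk>
      \<Longrightarrow> HComp A C D (Comp A B C f' f) (Comp A B C g' g) f'' g'' \<omega> (HComp A B C f g f' g' \<tau> \<theta>) =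
          HComp A B D f g (Comp B C D f'' f') (Comp B C D g'' g') (HComp B C D f' g' f'' g'' \<omega> \<tau>) \<theta>"


section \<open>Graded vector spaces and graded multilinear maps\<close>

text \<open>The field \<open>gr\<close> gives the homogeneous component of each integer degree.\<close>

record ('k, 'v) graded_module = "('k, 'v) module" +
  gr :: "int \<Rightarrow> 'v set"

locale two_term_graded_module =
  fixes K :: "('k, 'r) ring_scheme" (structure)
    and V :: "('k, 'v, 'z) graded_module_scheme" (structure)
  assumes is_module: "module K V"
    and gr_submodule: "submodule (gr V i) K V"
    and gr_trivial: "i \<noteq> 0 \<Longrightarrow> i \<noteq> 1 \<Longrightarrow> gr V i = {\<zero>\<^bsub>V\<^esub>}"
    and gr_sum: "carrier V = gr V 0 <+>\<^bsub>V\<^esub> gr V 1"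
    and gr_direct: "gr V 0 \<inter> gr V 1 = {\<zero>\<^bsub>V\<^esub>}"

text \<open>
  Maps are extensional (equal to \<open>undefined\<close> off the carriers), so that HOL equality of maps is
  equality of maps on the carriers.
\<close>

definition linear_maps ::
  "('k, 'r) ring_scheme \<Rightarrow> ('k, 'v, 'y) module_scheme \<Rightarrow> ('k, 'w, 'z) module_scheme \<Rightarrow> ('v \<Rightarrow> 'w) set"
  where
  "linear_maps K V W = {f \<in> carrier V \<rightarrow>\<^sub>E carrier W.
     (\<forall>x\<in>carrier V. \<forall>y\<in>carrier V. f (x \<oplus>\<^bsub>V\<^esub> y) = f x \<oplus>\<^bsub>W\<^esub> f y) \<and>
     (\<forall>a\<in>carrier K. \<forall>x\<in>carrier V. f (a \<odot>\<^bsub>V\<^esub> x) = a \<odot>\<^bsub>W\<^esub> f x)}"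

definition bilinear_maps ::
  "('k, 'r) ring_scheme \<Rightarrow> ('k, 'v, 'y) module_scheme \<Rightarrow> ('k, 'w, 'z) module_scheme
    \<Rightarrow> ('v \<Rightarrow> 'v \<Rightarrow> 'w) set"
  where
  "bilinear_maps K V W = {f \<in> carrier V \<rightarrow>\<^sub>E carrier V \<rightarrow>\<^sub>E carrier W.
     (\<forall>x\<in>carrier V. f x \<in> linear_maps K V W) \<and>
     (\<forall>y\<in>carrier V. (\<lambda>x\<in>carrier V. f x y) \<in> linear_maps K V W)}"

definition trilinear_maps ::
  "('k, 'r) ring_scheme \<Rightarrow> ('k, 'v, 'y) module_scheme \<Rightarrow> ('k, 'w, 'z) module_scheme
    \<Rightarrow> ('v \<Rightarrow> 'v \<Rightarrow> 'v \<Rightarrow> 'w) set"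
  where
  "trilinear_maps K V W = {f \<in> carrier V \<rightarrow>\<^sub>E carrier V \<rightarrow>\<^sub>E carrier V \<rightarrow>\<^sub>E carrier W.
     (\<forall>x\<in>carrier V. f x \<in> bilinear_maps K V W) \<and>
     (\<forall>y\<in>carrier V. \<forall>z\<in>carrier V. (\<lambda>x\<in>carrier V. f x y z) \<in> linear_maps K V W)}"

definition graded_linear_maps ::
  "('k, 'r) ring_scheme \<Rightarrow> int \<Rightarrow> ('k, 'v, 'y) graded_module_scheme
    \<Rightarrow> ('k, 'w, 'z) graded_module_scheme \<Rightarrow> ('v \<Rightarrow> 'w) set"
  where
  "graded_linear_maps K d V W = {f \<in> linear_maps K V W.
     \<forall>i. \<forall>x\<in>gr V i. f x \<in> gr W (i + d)}"

definition graded_bilinear_maps ::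
  "('k, 'r) ring_scheme \<Rightarrow> int \<Rightarrow> ('k, 'v, 'y) graded_module_scheme
    \<Rightarrow> ('k, 'w, 'z) graded_module_scheme \<Rightarrow> ('v \<Rightarrow> 'v \<Rightarrow> 'w) set"
  where
  "graded_bilinear_maps K d V W = {f \<in> bilinear_maps K V W.
     \<forall>i j. \<forall>x\<in>gr V i. \<forall>y\<in>gr V j. f x y \<in> gr W (i + j + d)}"

definition graded_trilinear_maps ::
  "('k, 'r) ring_scheme \<Rightarrow> int \<Rightarrow> ('k, 'v, 'y) graded_module_scheme
    \<Rightarrow> ('k, 'w, 'z) graded_module_scheme \<Rightarrow> ('v \<Rightarrow> 'v \<Rightarrow> 'v \<Rightarrow> 'w) set"
  where
  "graded_trilinear_maps K d V W = {f \<in> trilinear_maps K V W.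
     \<forall>i j k. \<forall>x\<in>gr V i. \<forall>y\<in>gr V j. \<forall>z\<in>gr V k. f x y z \<in> gr W (i + j + k + d)}"


section \<open>2-term Leibniz infinity algebras\<close>

record ('k, 'v) leibniz_infty = "('k, 'v) graded_module" +
  l1 :: "'v \<Rightarrow> 'v"
  l2 :: "'v \<Rightarrow> 'v \<Rightarrow> 'v"
  l3 :: "'v \<Rightarrow> 'v \<Rightarrow> 'v \<Rightarrow> 'v"

locale two_term_leibniz_infty_algebra =
  fixes K :: "('k, 'r) ring_scheme"
    and V :: "('k, 'v) leibniz_infty" (structure)
  assumes graded: "two_term_graded_module K V"
    and l1_graded: "l1 V \<in> graded_linear_maps K (-1) V V"
    and l2_graded: "l2 V \<in> graded_bilinear_maps K 0 V V"
    and l3_graded: "l3 V \<in> graded_trilinear_maps K 1 V V"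
    and a_left: "\<lbrakk>x \<in> gr V 0; h \<in> gr V 1\<rbrakk> \<Longrightarrow> l1 V (l2 V x h) = l2 V x (l1 V h)"
    and a_right: "\<lbrakk>x \<in> gr V 0; h \<in> gr V 1\<rbrakk> \<Longrightarrow> l1 V (l2 V h x) = l2 V (l1 V h) x"
    and b: "\<lbrakk>h \<in> gr V 1; k \<in> gr V 1\<rbrakk> \<Longrightarrow> l2 V (l1 V h) k = l2 V h (l1 V k)"
    and c: "\<lbrakk>x \<in> gr V 0; y \<in> gr V 0; z \<in> gr V 0\<rbrakk> \<Longrightarrow>
      l1 V (l3 V x y z) = l2 V x (l2 V y z) \<ominus> l2 V y (l2 V x z) \<ominus> l2 V (l2 V x y) z"
    and d_third: "\<lbrakk>x \<in> gr V 0; y \<in> gr V 0; h \<in> gr V 1\<rbrakk> \<Longrightarrow>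
      l3 V x y (l1 V h) = l2 V x (l2 V y h) \<ominus> l2 V y (l2 V x h) \<ominus> l2 V (l2 V x y) h"
    and d_second: "\<lbrakk>x \<in> gr V 0; y \<in> gr V 0; h \<in> gr V 1\<rbrakk> \<Longrightarrow>
      l3 V x (l1 V h) y = l2 V x (l2 V h y) \<ominus> l2 V h (l2 V x y) \<ominus> l2 V (l2 V x h) y"
    and d_first: "\<lbrakk>x \<in> gr V 0; y \<in> gr V 0; h \<in> gr V 1\<rbrakk> \<Longrightarrow>
      l3 V (l1 V h) x y = l2 V h (l2 V x y) \<ominus> l2 V x (l2 V h y) \<ominus> l2 V (l2 V h x) y"
    and e: "\<lbrakk>w \<in> gr V 0; x \<in> gr V 0; y \<in> gr V 0; z \<in> gr V 0\<rbrakk> \<Longrightarrow>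
      l2 V (l3 V w x y) z \<oplus> l2 V w (l3 V x y z) \<ominus> l2 V x (l3 V w y z) \<oplus> l2 V y (l3 V w x z)
      \<ominus> l3 V (l2 V w x) y z \<oplus> l3 V w (l2 V x y) z \<ominus> l3 V x (l2 V w y) z
      \<ominus> l3 V w x (l2 V y z) \<oplus> l3 V w y (l2 V x z) \<ominus> l3 V x y (l2 V w z) = \<zero>"


section \<open>Infinity morphisms\<close>

record ('v, 'w) infty_map =
  map1 :: "'v \<Rightarrow> 'w"
  map2 :: "'v \<Rightarrow> 'v \<Rightarrow> 'w"

locale infty_morphism =
  fixes K :: "('k, 'r) ring_scheme"
    and V :: "('k, 'v) leibniz_infty"
    and W :: "('k, 'w) leibniz_infty" (structure)
    and f :: "('v, 'w) infty_map"
  assumes map1_graded: "map1 f \<in> graded_linear_maps K 0 V W"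
    and map2_graded: "map2 f \<in> graded_bilinear_maps K 1 V W"
    and a: "h \<in> gr V 1 \<Longrightarrow> l1 W (map1 f h) = map1 f (l1 V h)"
    and b: "\<lbrakk>x \<in> gr V 0; y \<in> gr V 0\<rbrakk> \<Longrightarrow>
      l2 W (map1 f x) (map1 f y) \<oplus> l1 W (map2 f x y) = map1 f (l2 V x y)"
    and c_left: "\<lbrakk>x \<in> gr V 0; h \<in> gr V 1\<rbrakk> \<Longrightarrow>
      l2 W (map1 f x) (map1 f h) = map1 f (l2 V x h) \<ominus> map2 f x (l1 V h)"
    and c_right: "\<lbrakk>x \<in> gr V 0; h \<in> gr V 1\<rbrakk> \<Longrightarrow>
      l2 W (map1 f h) (map1 f x) = map1 f (l2 V h x) \<ominus> map2 f (l1 V h) x"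
    and d: "\<lbrakk>x \<in> gr V 0; y \<in> gr V 0; z \<in> gr V 0\<rbrakk> \<Longrightarrow>
      l3 W (map1 f x) (map1 f y) (map1 f z) \<ominus> l2 W (map2 f x y) (map1 f z)
        \<oplus> l2 W (map1 f x) (map2 f y z) \<ominus> l2 W (map1 f y) (map2 f x z)
      = map1 f (l3 V x y z) \<oplus> map2 f (l2 V x y) z \<ominus> map2 f x (l2 V y z) \<oplus> map2 f y (l2 V x z)"

definition infty_id :: "('k, 'v) leibniz_infty \<Rightarrow> ('v, 'v) infty_map" where
  "infty_id V = \<lparr>map1 = (\<lambda>x\<in>carrier V. x), map2 = (\<lambda>x\<in>carrier V. \<lambda>y\<in>carrier V. \<zero>\<^bsub>V\<^esub>)\<rparr>"

definition infty_comp ::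
  "('k, 'u) leibniz_infty \<Rightarrow> ('k, 'v) leibniz_infty \<Rightarrow> ('k, 'w) leibniz_infty
    \<Rightarrow> ('v, 'w) infty_map \<Rightarrow> ('u, 'v) infty_map \<Rightarrow> ('u, 'w) infty_map"
  where
  "infty_comp V W Y g f =
    \<lparr>map1 = (\<lambda>x\<in>carrier V. map1 g (map1 f x)),
     map2 = (\<lambda>x\<in>carrier V. \<lambda>y\<in>carrier V.
       map2 g (map1 f x) (map1 f y) \<oplus>\<^bsub>Y\<^esub> map1 g (map2 f x y))\<rparr>"


section \<open>2-term homotopies\<close>

locale infty_homotopy =
  fixes K :: "('k, 'r) ring_scheme"
    and V :: "('k, 'v) leibniz_infty"
    and W :: "('k, 'w) leibniz_infty" (structure)
    and f g :: "('v, 'w) infty_map"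
    and \<theta> :: "'v \<Rightarrow> 'w"
  assumes homotopy_graded: "\<theta> \<in> graded_linear_maps K 1 V W"
    and a: "x \<in> gr V 0 \<Longrightarrow> map1 g x \<ominus> map1 f x = l1 W (\<theta> x)"
    and b: "h \<in> gr V 1 \<Longrightarrow> map1 g h \<ominus> map1 f h = \<theta> (l1 V h)"
    and c: "\<lbrakk>x \<in> gr V 0; y \<in> gr V 0\<rbrakk> \<Longrightarrow>
      map2 g x y \<ominus> map2 f x y = \<theta> (l2 V x y) \<ominus> l2 W (map1 f x) (\<theta> y) \<ominus> l2 W (\<theta> x) (map1 g y)"

definition zero_homotopy ::
  "('k, 'v) leibniz_infty \<Rightarrow> ('k, 'w) leibniz_infty \<Rightarrow> ('v, 'w) infty_map \<Rightarrow> 'v \<Rightarrow> 'w"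
  where
  "zero_homotopy V W f = (\<lambda>x\<in>carrier V. \<zero>\<^bsub>W\<^esub>)"

definition homotopy_vcomp ::
  "('k, 'v) leibniz_infty \<Rightarrow> ('k, 'w) leibniz_infty
    \<Rightarrow> ('v, 'w) infty_map \<Rightarrow> ('v, 'w) infty_map \<Rightarrow> ('v, 'w) infty_map
    \<Rightarrow> ('v \<Rightarrow> 'w) \<Rightarrow> ('v \<Rightarrow> 'w) \<Rightarrow> 'v \<Rightarrow> 'w"
  where
  "homotopy_vcomp V W f g h \<tau> \<theta> = (\<lambda>x\<in>carrier V. \<tau> x \<oplus>\<^bsub>W\<^esub> \<theta> x)"

definition homotopy_hcomp ::
  "('k, 'u) leibniz_infty \<Rightarrow> ('k, 'v) leibniz_infty \<Rightarrow> ('k, 'w) leibniz_infty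
    \<Rightarrow> ('u, 'v) infty_map \<Rightarrow> ('u, 'v) infty_map \<Rightarrow> ('v, 'w) infty_map \<Rightarrow> ('v, 'w) infty_map
    \<Rightarrow> ('v \<Rightarrow> 'w) \<Rightarrow> ('u \<Rightarrow> 'v) \<Rightarrow> 'u \<Rightarrow> 'w"
  where
  "homotopy_hcomp V W Y f g f' g' \<tau> \<theta> =
    (\<lambda>x\<in>carrier V. map1 g' (\<theta> x) \<oplus>\<^bsub>Y\<^esub> \<tau> (map1 f x))"

end

theory Submission
  imports Defs
begin

text \<open>
  Every axiom of a morphism or a homotopy is an identity between sums and differences in the
  target.  To verify the axioms for a composite, one adds suitable instances of the axioms of the
  factors and cancels; the terms left over are removed by bilinearity and by the equations saying
  that the structure maps commute with \<open>l\<^sub>1\<close>.  For 1-morphisms the composite equation for \<open>l\<^sub>3\<close> is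
  \<open>g\<^sub>1\<close> applied to the equation for \<open>f\<close>, plus the equation for \<open>g\<close> at the images under \<open>f\<^sub>1\<close>; the
  terms \<open>g\<^sub>2 (l\<^sub>1 (f\<^sub>2 (x, y)), f\<^sub>1 z)\<close> appearing when \<open>g\<^sub>1\<close> is pulled through the bracket match the
  failure of \<open>f\<^sub>1\<close> to preserve the bracket strictly.

  For both compositions of homotopies, the equation for \<open>map2\<close> needs one thing more.  Comparing the
  two sides leaves the difference between \<open>l\<^sub>2 (l\<^sub>1 h, k)\<close> and \<open>l\<^sub>2 (h, l\<^sub>1 k)\<close> for two elements of
  degree 1 (values of the homotopies or their images under \<open>g'\<^sub>1\<close>), and these agree by axiom (b) of
  the algebra.

  The interchange law rests on the coincidence of the two formulas for horizontal composition
  (\<open>hcomp_commute\<close>).  In degree 0 both formulas differ from \<open>f'\<^sub>1 \<theta> + \<tau> f\<^sub>1\<close> by \<open>\<tau> l\<^sub>1 \<theta>\<close>; in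
  degree 1 both vanish, since a homotopy sends degree 1 to degree 2.  The other laws are
  associativity and unit laws of addition and composition.  Since all maps are extensional on the
  carriers, pointwise identities there give equalities of maps.
\<close>

section \<open>Equations in abelian groups\<close>

context abelian_group
begin

lemma minus_eq_iff:
  "\<lbrakk>a \<in> carrier G; b \<in> carrier G; c \<in> carrier G\<rbrakk> \<Longrightarrow> a \<ominus> b = c \<longleftrightarrow> a = c \<oplus> b"
  by (auto simp: a_minus_def a_assoc l_neg r_neg)

lemma eq_minus_iff:
  "\<lbrakk>a \<in> carrier G; b \<in> carrier G; c \<in> carrier G\<rbrakk> \<Longrightarrow> c = a \<ominus> b \<longleftrightarrow> c \<oplus> b = a"
  by (auto simp: a_minus_def a_assoc l_neg r_neg)

lemma minus_add_swap:
  "\<lbrakk>a \<in> carrier G; b \<in> carrier G; c \<in> carrier G\<rbrakk> \<Longrightarrow> (a \<ominus> b) \<oplus> c = (a \<oplus> c) \<ominus> b"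
  by (simp add: a_minus_def a_ac)

lemma add_minus_assoc:
  "\<lbrakk>a \<in> carrier G; b \<in> carrier G; c \<in> carrier G\<rbrakk> \<Longrightarrow> a \<oplus> (b \<ominus> c) = (a \<oplus> b) \<ominus> c"
  by (simp add: a_minus_def a_ac)

lemma minus_minus_eq:
  "\<lbrakk>a \<in> carrier G; b \<in> carrier G; c \<in> carrier G\<rbrakk> \<Longrightarrow> (a \<ominus> b) \<ominus> c = a \<ominus> (b \<oplus> c)"
  by (simp add: a_minus_def a_ac minus_add)

lemma minus_zero_right: "a \<in> carrier G \<Longrightarrow> a \<ominus> \<zero> = a"
  by (simp add: a_minus_def)

text \<open>Rewriting with these rules moves every subtracted term of an equation to the other side,
  so that only sums remain and associativity and commutativity decide what is left.\<close>

lemmas clear_minus = minus_eq_iff eq_minus_iff minus_add_swap add_minus_assoc minus_minus_eq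

text \<open>The step used for the long equations below: \<open>S = T\<close> is the sum of the known instances, and the
  second premise is then decided by rewriting with associativity and commutativity.\<close>

lemma eq_by_cancelling:
  assumes "S = T" and "P \<oplus> T = Q \<oplus> S"
    and "P \<in> carrier G" "Q \<in> carrier G" "S \<in> carrier G"
  shows "P = Q"
  using assms by simp

end


section \<open>Linear and bilinear maps on carriers\<close>

lemma linear_mapsD:
  assumes "f \<in> linear_maps K V W" and "x \<in> carrier V"
  shows "f x \<in> carrier W"
    and "y \<in> carrier V \<Longrightarrow> f (x \<oplus>\<^bsub>V\<^esub> y) = f x \<oplus>\<^bsub>W\<^esub> f y"
    and "a \<in> carrier K \<Longrightarrow> f (a \<odot>\<^bsub>V\<^esub> x) = a \<odot>\<^bsub>W\<^esub> f x"
  using assms by (auto simp: linear_maps_def)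

text \<open>Additivity in the first argument is stated in \<open>bilinear_maps\<close> for a map restricted to the
  carrier, so it can be read off only if the carrier is closed under the operations.\<close>

lemma bilinear_mapsD:
  assumes "f \<in> bilinear_maps K V W" and "x \<in> carrier V" and "y \<in> carrier V"
  shows "f x y \<in> carrier W"
    and "z \<in> carrier V \<Longrightarrow> f x (y \<oplus>\<^bsub>V\<^esub> z) = f x y \<oplus>\<^bsub>W\<^esub> f x z"
    and "a \<in> carrier K \<Longrightarrow> f x (a \<odot>\<^bsub>V\<^esub> y) = a \<odot>\<^bsub>W\<^esub> f x y"
    and "abelian_monoid V \<Longrightarrow> z \<in> carrier V \<Longrightarrow> f (x \<oplus>\<^bsub>V\<^esub> z) y = f x y \<oplus>\<^bsub>W\<^esub> f z y"
    and "module K V \<Longrightarrow> a \<in> carrier K \<Longrightarrow> f (a \<odot>\<^bsub>V\<^esub> x) y = a \<odot>\<^bsub>W\<^esub> f x y"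
proof -
  have right: "f x \<in> linear_maps K V W" and left: "(\<lambda>x\<in>carrier V. f x y) \<in> linear_maps K V W"
    using assms by (auto simp: bilinear_maps_def)
  show "f x y \<in> carrier W"
    and "z \<in> carrier V \<Longrightarrow> f x (y \<oplus>\<^bsub>V\<^esub> z) = f x y \<oplus>\<^bsub>W\<^esub> f x z"
    and "a \<in> carrier K \<Longrightarrow> f x (a \<odot>\<^bsub>V\<^esub> y) = a \<odot>\<^bsub>W\<^esub> f x y"
    using linear_mapsD[OF right] assms by auto
  show "f (x \<oplus>\<^bsub>V\<^esub> z) y = f x y \<oplus>\<^bsub>W\<^esub> f z y" if "abelian_monoid V" "z \<in> carrier V"
    using linear_mapsD(2)[OF left assms(2), of z] that assms abelian_monoid.a_closed[of V x z]
    by simp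
  show "f (a \<odot>\<^bsub>V\<^esub> x) y = a \<odot>\<^bsub>W\<^esub> f x y" if "module K V" "a \<in> carrier K"
    using linear_mapsD(3)[OF left assms(2), of a] that assms module.smult_closed[of K V a x]
    by simp
qed

lemma linear_maps_restrictI:
  assumes "module K V"
    and "\<And>x. x \<in> carrier V \<Longrightarrow> F x \<in> carrier W"
    and "\<And>x y. \<lbrakk>x \<in> carrier V; y \<in> carrier V\<rbrakk> \<Longrightarrow> F (x \<oplus>\<^bsub>V\<^esub> y) = F x \<oplus>\<^bsub>W\<^esub> F y"
    and "\<And>a x. \<lbrakk>a \<in> carrier K; x \<in> carrier V\<rbrakk> \<Longrightarrow> F (a \<odot>\<^bsub>V\<^esub> x) = a \<odot>\<^bsub>W\<^esub> F x"
  shows "(\<lambda>x\<in>carrier V. F x) \<in> linear_maps K V W"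
proof -
  interpret module K V by fact
  show ?thesis using assms(2-) by (simp add: linear_maps_def)
qed

lemma bilinear_maps_restrictI:
  assumes "module K V"
    and "\<And>x y. \<lbrakk>x \<in> carrier V; y \<in> carrier V\<rbrakk> \<Longrightarrow> F x y \<in> carrier W"
    and "\<And>x y z. \<lbrakk>x \<in> carrier V; y \<in> carrier V; z \<in> carrier V\<rbrakk>
      \<Longrightarrow> F (x \<oplus>\<^bsub>V\<^esub> y) z = F x z \<oplus>\<^bsub>W\<^esub> F y z"
    and "\<And>x y z. \<lbrakk>x \<in> carrier V; y \<in> carrier V; z \<in> carrier V\<rbrakk>
      \<Longrightarrow> F x (y \<oplus>\<^bsub>V\<^esub> z) = F x y \<oplus>\<^bsub>W\<^esub> F x z"
    and "\<And>a x y. \<lbrakk>a \<in> carrier K; x \<in> carrier V; y \<in> carrier V\<rbrakk>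
      \<Longrightarrow> F (a \<odot>\<^bsub>V\<^esub> x) y = a \<odot>\<^bsub>W\<^esub> F x y"
    and "\<And>a x y. \<lbrakk>a \<in> carrier K; x \<in> carrier V; y \<in> carrier V\<rbrakk>
      \<Longrightarrow> F x (a \<odot>\<^bsub>V\<^esub> y) = a \<odot>\<^bsub>W\<^esub> F x y"
  shows "(\<lambda>x\<in>carrier V. \<lambda>y\<in>carrier V. F x y) \<in> bilinear_maps K V W"
proof -
  have "(\<lambda>x\<in>carrier V. (\<lambda>x\<in>carrier V. \<lambda>y\<in>carrier V. F x y) x y) \<in> linear_maps K V W"
    if "y \<in> carrier V" for y
  proof -
    have "(\<lambda>x\<in>carrier V. F x y) \<in> linear_maps K V W"
      using assms that by (intro linear_maps_restrictI) auto
    moreover have "(\<lambda>x\<in>carrier V. (\<lambda>x\<in>carrier V. \<lambda>y\<in>carrier V. F x y) x y) = (\<lambda>x\<in>carrier V. F x y)"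
      using that by auto
    ultimately show ?thesis by simp
  qed
  moreover have "(\<lambda>x\<in>carrier V. \<lambda>y\<in>carrier V. F x y) x \<in> linear_maps K V W"
    if "x \<in> carrier V" for x
    using that assms linear_maps_restrictI[of K V "F x" W] by simp
  moreover have "(\<lambda>x\<in>carrier V. \<lambda>y\<in>carrier V. F x y) \<in> carrier V \<rightarrow>\<^sub>E carrier V \<rightarrow>\<^sub>E carrier W"
    using assms(2) by auto
  ultimately show ?thesis by (simp add: bilinear_maps_def)
qed

lemma linear_maps_restrict_eq: "f \<in> linear_maps K V W \<Longrightarrow> (\<lambda>x\<in>carrier V. f x) = f"
  by (auto simp: linear_maps_def)

lemma bilinear_maps_restrict_eq:
  "f \<in> bilinear_maps K V W \<Longrightarrow> (\<lambda>x\<in>carrier V. \<lambda>y\<in>carrier V. f x y) = f"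
  by (auto simp: bilinear_maps_def linear_maps_def PiE_def extensional_def fun_eq_iff)


section \<open>Rules for objects, morphisms and homotopies\<close>

context two_term_graded_module
begin

sublocale abelian_group V
  using is_module by (rule module.axioms)

lemma gr_carrier: "x \<in> gr V i \<Longrightarrow> x \<in> carrier V"
  using module.submoduleE(1)[OF is_module gr_submodule] by blast

lemmas gr_carrier01 [simp] = gr_carrier[where i = 0] gr_carrier[where i = 1]

lemma gr_add [simp]: "\<lbrakk>x \<in> gr V i; y \<in> gr V i\<rbrakk> \<Longrightarrow> x \<oplus>\<^bsub>V\<^esub> y \<in> gr V i"
  using module.submoduleE(5)[OF is_module gr_submodule] by blast

lemma gr_zero [simp]: "\<zero>\<^bsub>V\<^esub> \<in> gr V i"
  using subgroup.one_closed[OF submodule.axioms(1)[OF gr_submodule]] by simp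

lemma carrier_decompose:
  assumes "x \<in> carrier V"
  obtains x0 x1 where "x0 \<in> gr V 0" "x1 \<in> gr V 1" "x = x0 \<oplus>\<^bsub>V\<^esub> x1"
  using assms gr_sum by (auto simp: set_add_def')

lemma smult_gr_closed [simp]: "\<lbrakk>a \<in> carrier K; x \<in> carrier V\<rbrakk> \<Longrightarrow> a \<odot>\<^bsub>V\<^esub> x \<in> carrier V"
  by (rule module.smult_closed[OF is_module])

lemmas smult_add = module.smult_r_distr[OF is_module]
lemmas smult_zero [simp] = module.smult_r_null[OF is_module]

end

sublocale two_term_leibniz_infty_algebra \<subseteq> two_term_graded_module K V
  by (rule graded)

context two_term_leibniz_infty_algebra
begin

lemma l1_linear: "l1 V \<in> linear_maps K V V"
  using l1_graded by (simp add: graded_linear_maps_def)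

lemma l2_bilinear: "l2 V \<in> bilinear_maps K V V"
  using l2_graded by (simp add: graded_bilinear_maps_def)

lemmas l1_closed [simp] = linear_mapsD(1)[OF l1_linear]
lemmas l1_add = linear_mapsD(2)[OF l1_linear]
lemmas l2_closed [simp] = bilinear_mapsD(1)[OF l2_bilinear]
lemmas l2_add_right = bilinear_mapsD(2)[OF l2_bilinear]
lemmas l2_add_left = bilinear_mapsD(4)[OF l2_bilinear _ _ abelian_monoid_axioms]

lemma l1_zero [simp]: "l1 V \<zero> = \<zero>"
  using l1_add[of \<zero> \<zero>] by simp

lemma l2_zero_right [simp]: "x \<in> carrier V \<Longrightarrow> l2 V x \<zero> = \<zero>"
  using l2_add_right[of x \<zero> \<zero>] by simp

lemma l2_zero_left [simp]: "x \<in> carrier V \<Longrightarrow> l2 V \<zero> x = \<zero>"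
  using l2_add_left[of \<zero> x \<zero>] by simp

lemma l1_gr [simp]: "h \<in> gr V 1 \<Longrightarrow> l1 V h \<in> gr V 0"
  using l1_graded by (force simp: graded_linear_maps_def)

lemma l2_gr [simp]:
  "\<lbrakk>x \<in> gr V 0; y \<in> gr V 0\<rbrakk> \<Longrightarrow> l2 V x y \<in> gr V 0"
  "\<lbrakk>x \<in> gr V 0; h \<in> gr V 1\<rbrakk> \<Longrightarrow> l2 V x h \<in> gr V 1"
  "\<lbrakk>h \<in> gr V 1; x \<in> gr V 0\<rbrakk> \<Longrightarrow> l2 V h x \<in> gr V 1"
  using l2_graded by (force simp: graded_bilinear_maps_def)+

lemma l3_gr [simp]: "\<lbrakk>x \<in> gr V 0; y \<in> gr V 0; z \<in> gr V 0\<rbrakk> \<Longrightarrow> l3 V x y z \<in> gr V 1"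
  using l3_graded by (force simp: graded_trilinear_maps_def)

end

text \<open>The locale \<open>infty_morphism\<close> leaves source and target arbitrary; here they are algebras, so that
  sums in them can be rearranged.\<close>

locale leibniz_morphism =
  source: two_term_leibniz_infty_algebra K V + target: two_term_leibniz_infty_algebra K W +
  infty_morphism K V W f
  for K :: "('k, 'r) ring_scheme" and V :: "('k, 'v) leibniz_infty"
    and W :: "('k, 'w) leibniz_infty" (structure) and f
begin

lemma map1_linear: "map1 f \<in> linear_maps K V W"
  using map1_graded by (simp add: graded_linear_maps_def)

lemma map2_bilinear: "map2 f \<in> bilinear_maps K V W"
  using map2_graded by (simp add: graded_bilinear_maps_def)

lemmas map1_closed [simp] = linear_mapsD(1)[OF map1_linear]
lemmas map1_add = linear_mapsD(2)[OF map1_linear]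
lemmas map1_smult = linear_mapsD(3)[OF map1_linear]
lemmas map2_closed [simp] = bilinear_mapsD(1)[OF map2_bilinear]
lemmas map2_add_right = bilinear_mapsD(2)[OF map2_bilinear]
lemmas map2_smult_right = bilinear_mapsD(3)[OF map2_bilinear]
lemmas map2_add_left = bilinear_mapsD(4)[OF map2_bilinear _ _ source.abelian_monoid_axioms]
lemmas map2_smult_left = bilinear_mapsD(5)[OF map2_bilinear _ _ source.is_module]

lemma map1_zero [simp]: "map1 f \<zero>\<^bsub>V\<^esub> = \<zero>"
  using map1_add[of "\<zero>\<^bsub>V\<^esub>" "\<zero>\<^bsub>V\<^esub>"] by simp

lemma map1_gr [simp]: "x \<in> gr V i \<Longrightarrow> map1 f x \<in> gr W i"
  using map1_graded by (force simp: graded_linear_maps_def)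

lemma map2_gr: "\<lbrakk>x \<in> gr V i; y \<in> gr V j\<rbrakk> \<Longrightarrow> map2 f x y \<in> gr W (i + j + 1)"
  using map2_graded by (force simp: graded_bilinear_maps_def)

lemmas map2_gr0 [simp] = map2_gr[where i = 0 and j = 0, simplified]

lemma map1_l2_left:
  "\<lbrakk>x \<in> gr V 0; h \<in> gr V 1\<rbrakk> \<Longrightarrow>
    map1 f (l2 V x h) = l2 W (map1 f x) (map1 f h) \<oplus> map2 f x (l1 V h)"
  using c_left[of x h] by (simp add: target.clear_minus)

lemma map1_l2_right:
  "\<lbrakk>x \<in> gr V 0; h \<in> gr V 1\<rbrakk> \<Longrightarrow>
    map1 f (l2 V h x) = l2 W (map1 f h) (map1 f x) \<oplus> map2 f (l1 V h) x"
  using c_right[of x h] by (simp add: target.clear_minus)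

lemma map1_l3:
  "\<lbrakk>x \<in> gr V 0; y \<in> gr V 0; z \<in> gr V 0\<rbrakk> \<Longrightarrow>
    l3 W (map1 f x) (map1 f y) (map1 f z) \<oplus> l2 W (map1 f x) (map2 f y z) \<oplus> map2 f x (l2 V y z)
    = map1 f (l3 V x y z) \<oplus> map2 f (l2 V x y) z \<oplus> map2 f y (l2 V x z)
      \<oplus> l2 W (map2 f x y) (map1 f z) \<oplus> l2 W (map1 f y) (map2 f x z)"
  using d[of x y z] by (simp add: target.clear_minus target.a_ac)

end

locale leibniz_homotopy =
  F: leibniz_morphism K V W f + G: leibniz_morphism K V W g + infty_homotopy K V W f g \<theta>
  for K :: "('k, 'r) ring_scheme" and V :: "('k, 'v) leibniz_infty"
    and W :: "('k, 'w) leibniz_infty" (structure) and f g \<theta>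
begin

lemma linear: "\<theta> \<in> linear_maps K V W"
  using homotopy_graded by (simp add: graded_linear_maps_def)

lemmas closed [simp] = linear_mapsD(1)[OF linear]
lemmas hom_add = linear_mapsD(2)[OF linear]
lemmas hom_smult = linear_mapsD(3)[OF linear]

lemma gr: "x \<in> gr V i \<Longrightarrow> \<theta> x \<in> gr W (i + 1)"
  using homotopy_graded by (force simp: graded_linear_maps_def)

lemmas gr0 [simp] = gr[where i = 0, simplified]

lemma zero_on_gr1: "h \<in> gr V 1 \<Longrightarrow> \<theta> h = \<zero>"
  using gr[of h 1] F.target.gr_trivial[of 2] by simp

lemma map1_gr0: "x \<in> gr V 0 \<Longrightarrow> map1 g x = map1 f x \<oplus> l1 W (\<theta> x)"
  using a[of x] by (simp add: F.target.clear_minus F.target.a_ac)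

lemma map1_gr1: "h \<in> gr V 1 \<Longrightarrow> map1 g h = map1 f h \<oplus> \<theta> (l1 V h)"
  using b[of h] by (simp add: F.target.clear_minus F.target.a_ac)

lemma map2_gr0:
  "\<lbrakk>x \<in> gr V 0; y \<in> gr V 0\<rbrakk> \<Longrightarrow>
    map2 g x y \<oplus> l2 W (map1 f x) (\<theta> y) \<oplus> l2 W (\<theta> x) (map1 g y) = map2 f x y \<oplus> \<theta> (l2 V x y)"
  using c[of x y] by (simp add: F.target.clear_minus F.target.a_ac)

end


section \<open>Infinity morphisms form a category\<close>

lemma (in two_term_leibniz_infty_algebra) infty_id_morphism:
  "infty_morphism K V V (infty_id V)"
proof
  show "map1 (infty_id V) \<in> graded_linear_maps K 0 V V"
    using linear_maps_restrictI[OF is_module, of "\<lambda>x. x" V]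
    by (auto simp: infty_id_def graded_linear_maps_def gr_carrier)
  show "map2 (infty_id V) \<in> graded_bilinear_maps K 1 V V"
    using bilinear_maps_restrictI[OF is_module, of "\<lambda>x y. \<zero>" V]
    by (auto simp: infty_id_def graded_bilinear_maps_def gr_carrier)
qed (auto simp: infty_id_def minus_zero_right gr_carrier[OF l3_gr])

locale leibniz_composable =
  f: leibniz_morphism K V W f + g: leibniz_morphism K W Y g
  for K :: "('k, 'r) ring_scheme" and V :: "('k, 'u) leibniz_infty"
    and W :: "('k, 'v) leibniz_infty" and Y :: "('k, 'w) leibniz_infty" (structure) and f g
begin

abbreviation "gf \<equiv> infty_comp V W Y g f"

lemma map1_comp [simp]: "x \<in> carrier V \<Longrightarrow> map1 gf x = map1 g (map1 f x)"
  and map2_comp [simp]: "\<lbrakk>x \<in> carrier V; y \<in> carrier V\<rbrakk> \<Longrightarrow>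
    map2 gf x y = map2 g (map1 f x) (map1 f y) \<oplus> map1 g (map2 f x y)"
  by (simp_all add: infty_comp_def)

lemma map1_comp_graded: "map1 gf \<in> graded_linear_maps K 0 V Y"
  using linear_maps_restrictI[OF f.source.is_module, of "\<lambda>x. map1 g (map1 f x)" Y]
  by (auto simp: infty_comp_def graded_linear_maps_def f.source.gr_carrier
      f.map1_add g.map1_add f.map1_smult g.map1_smult)

lemma map2_comp_graded: "map2 gf \<in> graded_bilinear_maps K 1 V Y"
proof -
  have "map2 gf \<in> bilinear_maps K V Y"
    unfolding infty_comp_def infty_map.simps
    by (rule bilinear_maps_restrictI[OF f.source.is_module])
      (simp_all add: f.map1_add g.map1_add f.map1_smult g.map1_smult
        f.map2_add_left g.map2_add_left f.map2_add_right g.map2_add_right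
        f.map2_smult_left g.map2_smult_left f.map2_smult_right g.map2_smult_right
        g.target.smult_add g.target.a_ac)
  then show ?thesis
    by (auto simp: graded_bilinear_maps_def f.source.gr_carrier f.map2_gr g.map2_gr)
qed

lemma comp_l3:
  assumes xyz [simp]: "x \<in> gr V 0" "y \<in> gr V 0" "z \<in> gr V 0"
  shows "l3 Y (map1 gf x) (map1 gf y) (map1 gf z) \<ominus> l2 Y (map2 gf x y) (map1 gf z)
        \<oplus> l2 Y (map1 gf x) (map2 gf y z) \<ominus> l2 Y (map1 gf y) (map2 gf x z)
      = map1 gf (l3 V x y z) \<oplus> map2 gf (l2 V x y) z \<ominus> map2 gf x (l2 V y z) \<oplus> map2 gf y (l2 V x z)"
proof -
  note [simp] = f.source.gr_carrier[OF f.source.l3_gr] f.target.gr_carrier[OF f.target.l3_gr]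
    g.target.gr_carrier[OF g.target.l3_gr]
  note f_l2 = f.b[symmetric]
  have "map1 g (l3 W (map1 f x) (map1 f y) (map1 f z) \<oplus>\<^bsub>W\<^esub> l2 W (map1 f x) (map2 f y z)
          \<oplus>\<^bsub>W\<^esub> map2 f x (l2 V y z))
      = map1 g (map1 f (l3 V x y z) \<oplus>\<^bsub>W\<^esub> map2 f (l2 V x y) z \<oplus>\<^bsub>W\<^esub> map2 f y (l2 V x z)
          \<oplus>\<^bsub>W\<^esub> l2 W (map2 f x y) (map1 f z) \<oplus>\<^bsub>W\<^esub> l2 W (map1 f y) (map2 f x z))"
    by (rule arg_cong[OF f.map1_l3]) simp_all
  then have f_l3: "map1 g (l3 W (map1 f x) (map1 f y) (map1 f z))
        \<oplus> (l2 Y (map1 g (map1 f x)) (map1 g (map2 f y z)) \<oplus> map2 g (map1 f x) (l1 W (map2 f y z)))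
        \<oplus> map1 g (map2 f x (l2 V y z))
      = map1 g (map1 f (l3 V x y z)) \<oplus> map1 g (map2 f (l2 V x y) z) \<oplus> map1 g (map2 f y (l2 V x z))
        \<oplus> (l2 Y (map1 g (map2 f x y)) (map1 g (map1 f z)) \<oplus> map2 g (l1 W (map2 f x y)) (map1 f z))
        \<oplus> (l2 Y (map1 g (map1 f y)) (map1 g (map2 f x z)) \<oplus> map2 g (map1 f y) (l1 W (map2 f x z)))"
    by (simp add: g.map1_add g.map1_l2_left g.map1_l2_right)
  have g_l3: "l3 Y (map1 g (map1 f x)) (map1 g (map1 f y)) (map1 g (map1 f z))
        \<oplus> l2 Y (map1 g (map1 f x)) (map2 g (map1 f y) (map1 f z))
        \<oplus> map2 g (map1 f x) (l2 W (map1 f y) (map1 f z))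
      = map1 g (l3 W (map1 f x) (map1 f y) (map1 f z))
        \<oplus> map2 g (l2 W (map1 f x) (map1 f y)) (map1 f z)
        \<oplus> map2 g (map1 f y) (l2 W (map1 f x) (map1 f z))
        \<oplus> l2 Y (map2 g (map1 f x) (map1 f y)) (map1 g (map1 f z))
        \<oplus> l2 Y (map1 g (map1 f y)) (map2 g (map1 f x) (map1 f z))"
    by (rule g.map1_l3) simp_all
  \<comment> \<open>Expanding \<open>f\<^sub>1 l\<^sub>2\<close> inside \<open>g\<^sub>2\<close> in the goal gives the terms \<open>g\<^sub>2 (l\<^sub>1 f\<^sub>2, f\<^sub>1)\<close> and
    \<open>g\<^sub>2 (f\<^sub>1, l\<^sub>1 f\<^sub>2)\<close> of the equation \<open>f_l3\<close>, and the terms \<open>g\<^sub>2 (l\<^sub>2 (f\<^sub>1, f\<^sub>1), f\<^sub>1)\<close> of \<open>g_l3\<close>.\<close>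
  show ?thesis
    apply (simp add: g.target.clear_minus f_l2 g.map1_add g.map2_add_left g.map2_add_right
        g.target.l2_add_left g.target.l2_add_right)
    apply (rule g.target.eq_by_cancelling[OF arg_cong2[where f="(\<oplus>)", OF f_l3 g_l3]])
    apply (simp_all add: g.target.a_ac)
    done
qed

lemma infty_comp_morphism: "infty_morphism K V Y gf"
proof
  fix x y assume xy [simp]: "x \<in> gr V 0" "y \<in> gr V 0"
  have "map1 g (map1 f (l2 V x y))
      = map1 g (l2 W (map1 f x) (map1 f y)) \<oplus> map1 g (l1 W (map2 f x y))"
    by (simp add: f.b[symmetric] g.map1_add)
  then show "l2 Y (map1 gf x) (map1 gf y) \<oplus> l1 Y (map2 gf x y) = map1 gf (l2 V x y)"
    by (simp add: g.b[symmetric] g.a[symmetric] g.target.l1_add g.target.a_assoc)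
next
  fix x h assume xh [simp]: "x \<in> gr V 0" "h \<in> gr V 1"
  show "l2 Y (map1 gf x) (map1 gf h) = map1 gf (l2 V x h) \<ominus> map2 gf x (l1 V h)"
    by (simp add: g.target.clear_minus f.map1_l2_left g.map1_l2_left g.map1_add f.a
        g.target.a_ac)
  show "l2 Y (map1 gf h) (map1 gf x) = map1 gf (l2 V h x) \<ominus> map2 gf (l1 V h) x"
    by (simp add: g.target.clear_minus f.map1_l2_right g.map1_l2_right g.map1_add f.a
        g.target.a_ac)
next
  fix h assume "h \<in> gr V 1"
  then show "l1 Y (map1 gf h) = map1 gf (l1 V h)"
    by (simp add: g.a f.a)
qed (simp_all only: map1_comp_graded map2_comp_graded comp_l3)

end


lemma (in leibniz_morphism) comp_id_left: "infty_comp V W W (infty_id W) f = f"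
proof (rule infty_map.equality)
  have "map1 (infty_comp V W W (infty_id W) f) = (\<lambda>x\<in>carrier V. map1 f x)"
    by (auto simp: infty_comp_def infty_id_def)
  then show "map1 (infty_comp V W W (infty_id W) f) = map1 f"
    by (simp add: linear_maps_restrict_eq[OF map1_linear])
  have "map2 (infty_comp V W W (infty_id W) f) = (\<lambda>x\<in>carrier V. \<lambda>y\<in>carrier V. map2 f x y)"
    by (auto simp: infty_comp_def infty_id_def fun_eq_iff)
  then show "map2 (infty_comp V W W (infty_id W) f) = map2 f"
    by (simp add: bilinear_maps_restrict_eq[OF map2_bilinear])
qed simp

lemma (in leibniz_morphism) comp_id_right: "infty_comp V V W f (infty_id V) = f"
proof (rule infty_map.equality)
  have "map1 (infty_comp V V W f (infty_id V)) = (\<lambda>x\<in>carrier V. map1 f x)"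
    by (auto simp: infty_comp_def infty_id_def)
  then show "map1 (infty_comp V V W f (infty_id V)) = map1 f"
    by (simp add: linear_maps_restrict_eq[OF map1_linear])
  have "map2 (infty_comp V V W f (infty_id V)) = (\<lambda>x\<in>carrier V. \<lambda>y\<in>carrier V. map2 f x y)"
    by (auto simp: infty_comp_def infty_id_def fun_eq_iff)
  then show "map2 (infty_comp V V W f (infty_id V)) = map2 f"
    by (simp add: bilinear_maps_restrict_eq[OF map2_bilinear])
qed simp

lemma infty_comp_assoc:
  assumes "leibniz_morphism K U V f" "leibniz_morphism K V W g" "leibniz_morphism K W Y h"
  shows "infty_comp U W Y h (infty_comp U V W g f) = infty_comp U V Y (infty_comp V W Y h g) f"
proof -
  interpret f: leibniz_morphism K U V f by fact
  interpret g: leibniz_morphism K V W g by fact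
  interpret h: leibniz_morphism K W Y h by fact
  show ?thesis
    by (auto simp: infty_comp_def fun_eq_iff h.map1_add h.target.a_assoc)
qed

theorem category_leibniz:
  "category {V :: ('k, 'v) leibniz_infty. two_term_leibniz_infty_algebra K V}
    (\<lambda>V W. {f. infty_morphism K V W f}) infty_id infty_comp"
proof
  fix A B C :: "('k, 'v) leibniz_infty" and f g
  assume "A \<in> Collect (two_term_leibniz_infty_algebra K)"
    "B \<in> Collect (two_term_leibniz_infty_algebra K)"
    "C \<in> Collect (two_term_leibniz_infty_algebra K)"
    "f \<in> {f. infty_morphism K A B f}" "g \<in> {f. infty_morphism K B C f}"
  then interpret leibniz_composable K A B C f g
    by (simp add: leibniz_composable_def leibniz_morphism_def)
  show "infty_comp A B C g f \<in> {f. infty_morphism K A C f}"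
    by (simp add: infty_comp_morphism)
qed (auto simp: two_term_leibniz_infty_algebra.infty_id_morphism leibniz_morphism_def
    intro!: leibniz_morphism.comp_id_left leibniz_morphism.comp_id_right infty_comp_assoc)


section \<open>Vertical composition\<close>

lemma (in leibniz_morphism) zero_homotopy:
  "infty_homotopy K V W f f (zero_homotopy V W f)"
proof
  show "zero_homotopy V W f \<in> graded_linear_maps K 1 V W"
    using linear_maps_restrictI[OF source.is_module, of "\<lambda>x. \<zero>" W]
    by (auto simp: zero_homotopy_def graded_linear_maps_def source.gr_carrier)
qed (auto simp: zero_homotopy_def target.minus_zero_right target.clear_minus)

locale leibniz_vcomposable =
  theta: leibniz_homotopy K V W f g \<theta> + tau: leibniz_homotopy K V W g h \<tau>
  for K :: "('k, 'r) ring_scheme" and V :: "('k, 'v) leibniz_infty"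
    and W :: "('k, 'w) leibniz_infty" (structure) and f g h \<theta> \<tau>
begin

lemma vcomp_homotopy: "infty_homotopy K V W f h (homotopy_vcomp V W f g h \<tau> \<theta>)"
proof
  show "homotopy_vcomp V W f g h \<tau> \<theta> \<in> graded_linear_maps K 1 V W"
    using linear_maps_restrictI[OF theta.F.source.is_module, of "\<lambda>x. \<tau> x \<oplus> \<theta> x" W]
    by (auto simp: homotopy_vcomp_def graded_linear_maps_def theta.F.source.gr_carrier
        theta.hom_add tau.hom_add theta.hom_smult tau.hom_smult theta.gr tau.gr
        theta.F.target.smult_add theta.F.target.a_ac)
next
  fix x y assume [simp]: "x \<in> gr V 0" "y \<in> gr V 0"
  show "map2 h x y \<ominus> map2 f x y = homotopy_vcomp V W f g h \<tau> \<theta> (l2 V x y)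
      \<ominus> l2 W (map1 f x) (homotopy_vcomp V W f g h \<tau> \<theta> y)
      \<ominus> l2 W (homotopy_vcomp V W f g h \<tau> \<theta> x) (map1 h y)"
    \<comment> \<open>The sum of the two given equations has \<open>l\<^sub>2 (l\<^sub>1 \<theta> x, \<tau> y)\<close> where the goal has
      \<open>l\<^sub>2 (\<theta> x, l\<^sub>1 \<tau> y)\<close>.\<close>
    apply (simp add: homotopy_vcomp_def theta.F.target.clear_minus)
    apply (rule theta.F.target.eq_by_cancelling
        [OF arg_cong2[where f="(\<oplus>)", OF theta.map2_gr0[of x y] tau.map2_gr0[of x y]]])
    apply (simp_all add: theta.map1_gr0 tau.map1_gr0 theta.F.target.l2_add_left
        theta.F.target.l2_add_right theta.F.target.b theta.F.target.a_ac)
    done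
qed (auto simp: homotopy_vcomp_def theta.map1_gr0 tau.map1_gr0 theta.map1_gr1 tau.map1_gr1
    theta.F.target.l1_add theta.F.target.clear_minus theta.F.target.a_ac)

end

lemma (in leibniz_homotopy) vcomp_zero:
  "homotopy_vcomp V W f f g \<theta> (zero_homotopy V W f) = \<theta>"
  "homotopy_vcomp V W f g g (zero_homotopy V W g) \<theta> = \<theta>"
  using linear_maps_restrict_eq[OF linear]
  by (auto simp: homotopy_vcomp_def zero_homotopy_def cong: restrict_cong)

theorem category_homotopies:
  assumes "two_term_leibniz_infty_algebra K V" "two_term_leibniz_infty_algebra K W"
  shows "category {f. infty_morphism K V W f} (\<lambda>f g. {\<theta>. infty_homotopy K V W f g \<theta>})
    (zero_homotopy V W) (homotopy_vcomp V W)"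
proof
  have hom: "leibniz_homotopy K V W f g \<theta>"
    if "f \<in> {f. infty_morphism K V W f}" "g \<in> {f. infty_morphism K V W f}"
      "\<theta> \<in> {\<theta>. infty_homotopy K V W f g \<theta>}" for f g \<theta>
    using assms that by (simp add: leibniz_homotopy_def leibniz_morphism_def)
  interpret W: two_term_leibniz_infty_algebra K W by fact
  fix f g h k \<theta> \<tau> \<omega>
  assume f: "f \<in> {f. infty_morphism K V W f}" and g: "g \<in> {f. infty_morphism K V W f}"
  show "zero_homotopy V W f \<in> {\<theta>. infty_homotopy K V W f f \<theta>}"
    using f assms leibniz_morphism.zero_homotopy by (auto simp: leibniz_morphism_def)
  assume \<theta>: "\<theta> \<in> {\<theta>. infty_homotopy K V W f g \<theta>}"
  interpret theta: leibniz_homotopy K V W f g \<theta> by (rule hom[OF f g \<theta>])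
  show "homotopy_vcomp V W f f g \<theta> (zero_homotopy V W f) = \<theta>"
    and "homotopy_vcomp V W f g g (zero_homotopy V W g) \<theta> = \<theta>"
    by (fact theta.vcomp_zero)+
  assume h: "h \<in> {f. infty_morphism K V W f}" and \<tau>: "\<tau> \<in> {\<theta>. infty_homotopy K V W g h \<theta>}"
  interpret tau: leibniz_homotopy K V W g h \<tau> by (rule hom[OF g h \<tau>])
  interpret leibniz_vcomposable K V W f g h \<theta> \<tau> ..
  show "homotopy_vcomp V W f g h \<tau> \<theta> \<in> {\<theta>. infty_homotopy K V W f h \<theta>}"
    by (simp add: vcomp_homotopy)
  assume k: "k \<in> {f. infty_morphism K V W f}" and \<omega>: "\<omega> \<in> {\<theta>. infty_homotopy K V W h k \<theta>}"
  interpret omega: leibniz_homotopy K V W h k \<omega> by (rule hom[OF h k \<omega>])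
  show "homotopy_vcomp V W f h k \<omega> (homotopy_vcomp V W f g h \<tau> \<theta>)
      = homotopy_vcomp V W f g k (homotopy_vcomp V W g h k \<omega> \<tau>) \<theta>"
    by (auto simp: homotopy_vcomp_def W.a_assoc cong: restrict_cong)
qed


section \<open>Horizontal composition\<close>

locale leibniz_hcomposable =
  theta: leibniz_homotopy K V W f g \<theta> + tau: leibniz_homotopy K W Y f' g' \<tau>
  for K :: "('k, 'r) ring_scheme" and V :: "('k, 'u) leibniz_infty"
    and W :: "('k, 'v) leibniz_infty" and Y :: "('k, 'w) leibniz_infty" (structure)
    and f g f' g' \<theta> \<tau>
begin

text \<open>It suffices to compare homogeneous components.  For \<open>x\<close> of degree 0, \<open>g'\<^sub>1 \<theta> x - f'\<^sub>1 \<theta> x\<close> and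
  \<open>\<tau> g\<^sub>1 x - \<tau> f\<^sub>1 x\<close> are both \<open>\<tau> l\<^sub>1 \<theta> x\<close>; for \<open>x\<close> of degree 1 all terms vanish.\<close>

lemma hcomp_commute:
  assumes "x \<in> carrier V"
  shows "map1 g' (\<theta> x) \<oplus> \<tau> (map1 f x) = map1 f' (\<theta> x) \<oplus> \<tau> (map1 g x)"
  using assms
proof (rule theta.F.source.carrier_decompose)
  fix x0 x1 assume x: "x0 \<in> gr V 0" "x1 \<in> gr V 1" "x = x0 \<oplus>\<^bsub>V\<^esub> x1"
  then show ?thesis
    by (simp add: theta.hom_add theta.F.map1_add theta.G.map1_add tau.hom_add theta.zero_on_gr1
        tau.zero_on_gr1 theta.map1_gr0 tau.map1_gr1 tau.F.target.a_ac)
qed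

lemma homotopy_hcomp_eq:
  "homotopy_hcomp V W Y f g f' g' \<tau> \<theta> = (\<lambda>x\<in>carrier V. map1 f' (\<theta> x) \<oplus> \<tau> (map1 g x))"
  by (auto simp: homotopy_hcomp_def hcomp_commute cong: restrict_cong)

lemma hcomp_homotopy:
  "infty_homotopy K V Y (infty_comp V W Y f' f) (infty_comp V W Y g' g)
    (homotopy_hcomp V W Y f g f' g' \<tau> \<theta>)"
proof
  show "homotopy_hcomp V W Y f g f' g' \<tau> \<theta> \<in> graded_linear_maps K 1 V Y"
    using linear_maps_restrictI[OF theta.F.source.is_module,
        of "\<lambda>x. map1 g' (\<theta> x) \<oplus> \<tau> (map1 f x)" Y]
    by (auto simp: homotopy_hcomp_def graded_linear_maps_def theta.F.source.gr_carrier
        theta.hom_add tau.hom_add theta.hom_smult tau.hom_smult theta.gr tau.gr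
        theta.F.map1_add tau.G.map1_add theta.F.map1_smult tau.G.map1_smult
        tau.F.target.smult_add tau.F.target.a_ac)
next
  fix x y assume [simp]: "x \<in> gr V 0" "y \<in> gr V 0"
  have "map1 g' (map2 g x y \<oplus>\<^bsub>W\<^esub> l2 W (map1 f x) (\<theta> y) \<oplus>\<^bsub>W\<^esub> l2 W (\<theta> x) (map1 g y))
      = map1 g' (map2 f x y \<oplus>\<^bsub>W\<^esub> \<theta> (l2 V x y))"
    by (rule arg_cong[OF theta.map2_gr0]) simp_all
  then have theta_c: "map1 g' (map2 g x y)
      \<oplus> (l2 Y (map1 g' (map1 f x)) (map1 g' (\<theta> y)) \<oplus> map2 g' (map1 f x) (l1 W (\<theta> y)))
      \<oplus> (l2 Y (map1 g' (\<theta> x)) (map1 g' (map1 g y)) \<oplus> map2 g' (l1 W (\<theta> x)) (map1 g y))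
      = map1 g' (map2 f x y) \<oplus> map1 g' (\<theta> (l2 V x y))"
    by (simp add: tau.G.map1_add tau.G.map1_l2_left tau.G.map1_l2_right)
  have tau_c: "map2 g' (map1 f x) (map1 f y) \<oplus> l2 Y (map1 f' (map1 f x)) (\<tau> (map1 f y))
      \<oplus> l2 Y (\<tau> (map1 f x)) (map1 g' (map1 f y))
      = map2 f' (map1 f x) (map1 f y) \<oplus> \<tau> (l2 W (map1 f x) (map1 f y))"
    by (rule tau.map2_gr0) simp_all
  show "map2 (infty_comp V W Y g' g) x y \<ominus> map2 (infty_comp V W Y f' f) x y
      = homotopy_hcomp V W Y f g f' g' \<tau> \<theta> (l2 V x y)
        \<ominus> l2 Y (map1 (infty_comp V W Y f' f) x) (homotopy_hcomp V W Y f g f' g' \<tau> \<theta> y)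
        \<ominus> l2 Y (homotopy_hcomp V W Y f g f' g' \<tau> \<theta> x) (map1 (infty_comp V W Y g' g) y)"
    \<comment> \<open>Rewriting \<open>g'\<^sub>1\<close> to \<open>f'\<^sub>1\<close> is confined to the arguments \<open>f\<^sub>1 x\<close> and \<open>f\<^sub>2 (x, y)\<close>: these
      are the places where goal and known equations disagree.  What remains is
      \<open>l\<^sub>2 (l\<^sub>1 \<tau> f\<^sub>1 x, g'\<^sub>1 \<theta> y) = l\<^sub>2 (\<tau> f\<^sub>1 x, l\<^sub>1 g'\<^sub>1 \<theta> y)\<close>.\<close>
    apply (simp add: homotopy_hcomp_def infty_comp_def tau.F.target.clear_minus)
    apply (rule tau.F.target.eq_by_cancelling[OF arg_cong2[where f="(\<oplus>)", OF theta_c tau_c]])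
    apply (simp_all add: theta.map1_gr0 tau.map1_gr0[of "map1 f x"] tau.map1_gr1[of "map2 f x y"]
        theta.F.b[symmetric] tau.hom_add tau.G.map1_add tau.G.map2_add_left tau.G.map2_add_right
        tau.F.target.l2_add_left tau.F.target.l2_add_right
        tau.F.target.b tau.G.a tau.F.target.a_ac)
    done
qed (auto simp: homotopy_hcomp_def infty_comp_def theta.map1_gr0 tau.map1_gr0 theta.map1_gr1
    tau.map1_gr1 theta.F.a tau.F.a tau.G.a theta.F.target.l1_add tau.F.target.l1_add
    tau.F.map1_add tau.G.map1_add tau.hom_add
    tau.F.target.clear_minus tau.F.target.a_ac)

end

lemma (in leibniz_composable) hcomp_zero:
  "homotopy_hcomp V W Y f f g g (zero_homotopy W Y g) (zero_homotopy V W f)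
    = zero_homotopy V Y (infty_comp V W Y g f)"
  by (auto simp: homotopy_hcomp_def zero_homotopy_def)

lemma (in leibniz_homotopy) hcomp_unit:
  "homotopy_hcomp V W W f g (infty_id W) (infty_id W) (zero_homotopy W W (infty_id W)) \<theta> = \<theta>"
  "homotopy_hcomp V V W (infty_id V) (infty_id V) f g \<theta> (zero_homotopy V V (infty_id V)) = \<theta>"
  using linear_maps_restrict_eq[OF linear]
  by (auto simp: homotopy_hcomp_def zero_homotopy_def infty_id_def cong: restrict_cong)

lemma hcomp_assoc:
  assumes "leibniz_homotopy K U V f g \<theta>" "leibniz_homotopy K V W f' g' \<tau>"
    "leibniz_homotopy K W Y f'' g'' \<omega>"
  shows "homotopy_hcomp U W Y (infty_comp U V W f' f) (infty_comp U V W g' g) f'' g'' \<omega>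
      (homotopy_hcomp U V W f g f' g' \<tau> \<theta>)
    = homotopy_hcomp U V Y f g (infty_comp V W Y f'' f') (infty_comp V W Y g'' g')
      (homotopy_hcomp V W Y f' g' f'' g'' \<omega> \<tau>) \<theta>"
proof -
  interpret theta: leibniz_homotopy K U V f g \<theta> by fact
  interpret tau: leibniz_homotopy K V W f' g' \<tau> by fact
  interpret omega: leibniz_homotopy K W Y f'' g'' \<omega> by fact
  show ?thesis
    by (auto simp: homotopy_hcomp_def infty_comp_def omega.G.map1_add omega.F.target.a_assoc
        fun_eq_iff)
qed

text \<open>Both sides are a sum of one contribution of each homotopy, except that \<open>\<theta>\<close> and \<open>\<tau>'\<close> contribute
  \<open>h'\<^sub>1 \<theta> + \<tau>' f\<^sub>1\<close> on the left and \<open>g'\<^sub>1 \<theta> + \<tau>' g\<^sub>1\<close> on the right.  These are the two formulas for the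
  horizontal composite of \<open>\<theta>\<close> and \<open>\<tau>'\<close>.\<close>

lemma homotopy_interchange:
  assumes "leibniz_homotopy K V W f g \<theta>" "leibniz_homotopy K V W g h \<theta>'"
    "leibniz_homotopy K W Y f' g' \<tau>" "leibniz_homotopy K W Y g' h' \<tau>'"
  shows "homotopy_hcomp V W Y f h f' h' (homotopy_vcomp W Y f' g' h' \<tau>' \<tau>)
      (homotopy_vcomp V W f g h \<theta>' \<theta>)
    = homotopy_vcomp V Y (infty_comp V W Y f' f) (infty_comp V W Y g' g) (infty_comp V W Y h' h)
      (homotopy_hcomp V W Y g h g' h' \<tau>' \<theta>') (homotopy_hcomp V W Y f g f' g' \<tau> \<theta>)"
proof -
  interpret theta: leibniz_homotopy K V W f g \<theta> by fact
  interpret theta': leibniz_homotopy K V W g h \<theta>' by fact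
  interpret tau: leibniz_homotopy K W Y f' g' \<tau> by fact
  interpret tau': leibniz_homotopy K W Y g' h' \<tau>' by fact
  interpret mid: leibniz_hcomposable K V W Y f g g' h' \<theta> \<tau>' ..
  have "map1 h' (\<theta>' x \<oplus>\<^bsub>W\<^esub> \<theta> x) \<oplus>\<^bsub>Y\<^esub> (\<tau>' (map1 f x) \<oplus>\<^bsub>Y\<^esub> \<tau> (map1 f x))
      = map1 h' (\<theta>' x) \<oplus>\<^bsub>Y\<^esub> \<tau>' (map1 g x) \<oplus>\<^bsub>Y\<^esub> (map1 g' (\<theta> x) \<oplus>\<^bsub>Y\<^esub> \<tau> (map1 f x))"
    if [simp]: "x \<in> carrier V" for x
  proof -
    have "map1 h' (\<theta>' x \<oplus>\<^bsub>W\<^esub> \<theta> x) \<oplus>\<^bsub>Y\<^esub> (\<tau>' (map1 f x) \<oplus>\<^bsub>Y\<^esub> \<tau> (map1 f x))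
        = map1 h' (\<theta>' x) \<oplus>\<^bsub>Y\<^esub> (map1 h' (\<theta> x) \<oplus>\<^bsub>Y\<^esub> \<tau>' (map1 f x)) \<oplus>\<^bsub>Y\<^esub> \<tau> (map1 f x)"
      by (simp add: tau'.G.map1_add tau.F.target.a_assoc)
    also have "\<dots> = map1 h' (\<theta>' x) \<oplus>\<^bsub>Y\<^esub> (map1 g' (\<theta> x) \<oplus>\<^bsub>Y\<^esub> \<tau>' (map1 g x)) \<oplus>\<^bsub>Y\<^esub> \<tau> (map1 f x)"
      by (simp only: mid.hcomp_commute[OF that])
    finally show ?thesis
      by (simp add: tau.F.target.a_ac)
  qed
  then show ?thesis
    by (auto simp: homotopy_hcomp_def homotopy_vcomp_def cong: restrict_cong)
qed


section \<open>The strict 2-category\<close>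

theorem proposition11:
  fixes K :: "('k, 'r) ring_scheme"
  assumes "field K"
    and char_0: "\<And>n::nat. n > 0 \<Longrightarrow> [n] \<cdot>\<^bsub>K\<^esub> \<one>\<^bsub>K\<^esub> \<noteq> \<zero>\<^bsub>K\<^esub>"
  shows "strict_two_category
      {V :: ('k, 'v) leibniz_infty. two_term_leibniz_infty_algebra K V}
      (\<lambda>V W. {f. infty_morphism K V W f})
      infty_id
      infty_comp
      (\<lambda>V W f g. {\<theta>. infty_homotopy K V W f g \<theta>})
      zero_homotopy
      homotopy_vcomp
      homotopy_hcomp
    \<and> (\<forall>(V :: ('k, 'v) leibniz_infty) (W :: ('k, 'v) leibniz_infty) (Y :: ('k, 'v) leibniz_infty)
          f g f' g' \<theta> \<tau>.
        two_term_leibniz_infty_algebra K V \<longrightarrow>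
        two_term_leibniz_infty_algebra K W \<longrightarrow>
        two_term_leibniz_infty_algebra K Y \<longrightarrow>
        infty_morphism K V W f \<longrightarrow> infty_morphism K V W g \<longrightarrow>
        infty_morphism K W Y f' \<longrightarrow> infty_morphism K W Y g' \<longrightarrow>
        infty_homotopy K V W f g \<theta> \<longrightarrow> infty_homotopy K W Y f' g' \<tau> \<longrightarrow>
        homotopy_hcomp V W Y f g f' g' \<tau> \<theta> =
          (\<lambda>x\<in>carrier V. map1 f' (\<theta> x) \<oplus>\<^bsub>Y\<^esub> \<tau> (map1 g x)))"
proof -
  define Ob where "Ob = {V :: ('k, 'v) leibniz_infty. two_term_leibniz_infty_algebra K V}"
  define Hom where "Hom = (\<lambda>(V :: ('k, 'v) leibniz_infty) (W :: ('k, 'v) leibniz_infty).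
    {f. infty_morphism K V W f})"
  define Cell where "Cell = (\<lambda>(V :: ('k, 'v) leibniz_infty) (W :: ('k, 'v) leibniz_infty) f g.
    {\<theta>. infty_homotopy K V W f g \<theta>})"
  have mor: "leibniz_morphism K V W f" if "V \<in> Ob" "W \<in> Ob" "f \<in> Hom V W" for V W f
    using that by (simp add: Ob_def Hom_def leibniz_morphism_def)
  have hom: "leibniz_homotopy K V W f g \<theta>"
    if "V \<in> Ob" "W \<in> Ob" "f \<in> Hom V W" "g \<in> Hom V W" "\<theta> \<in> Cell V W f g" for V W f g \<theta>
    using that mor by (simp add: Hom_def Cell_def leibniz_homotopy_def)
  have hcomp: "leibniz_hcomposable K V W Y f g f' g' \<theta> \<tau>"
    if "V \<in> Ob" "W \<in> Ob" "Y \<in> Ob" "f \<in> Hom V W" "g \<in> Hom V W" "f' \<in> Hom W Y" "g' \<in> Hom W Y"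
      "\<theta> \<in> Cell V W f g" "\<tau> \<in> Cell W Y f' g'" for V W Y f g f' g' \<theta> \<tau>
    using that hom by (simp add: leibniz_hcomposable_def)
  have "category Ob Hom infty_id infty_comp"
    unfolding Ob_def Hom_def by (rule category_leibniz)
  moreover have "category (Hom V W) (Cell V W) (zero_homotopy V W) (homotopy_vcomp V W)"
    if "V \<in> Ob" "W \<in> Ob" for V W
    using that category_homotopies by (simp add: Ob_def Hom_def Cell_def)
  ultimately have "strict_two_category Ob Hom infty_id infty_comp Cell
    zero_homotopy homotopy_vcomp homotopy_hcomp"
  proof (intro strict_two_category.intro strict_two_category_axioms.intro)
    show "homotopy_hcomp A B C f g f' g' \<tau> \<theta> \<in> Cell A C (infty_comp A B C f' f) (infty_comp A B C g' g)"
      if "A \<in> Ob" "B \<in> Ob" "C \<in> Ob" "f \<in> Hom A B" "g \<in> Hom A B" "f' \<in> Hom B C" "g' \<in> Hom B C"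
        "\<theta> \<in> Cell A B f g" "\<tau> \<in> Cell B C f' g'" for A B C f g f' g' \<theta> \<tau>
      using leibniz_hcomposable.hcomp_homotopy[OF hcomp[OF that]] by (simp add: Cell_def)
    show "homotopy_hcomp A B C f f f' f' (zero_homotopy B C f') (zero_homotopy A B f)
        = zero_homotopy A C (infty_comp A B C f' f)"
      if "A \<in> Ob" "B \<in> Ob" "C \<in> Ob" "f \<in> Hom A B" "f' \<in> Hom B C" for A B C f f'
      using that mor by (intro leibniz_composable.hcomp_zero leibniz_composable.intro)
  qed (auto intro: homotopy_interchange hcomp_assoc leibniz_homotopy.hcomp_unit hom)
  moreover have "homotopy_hcomp V W Y f g f' g' \<tau> \<theta>
      = (\<lambda>x\<in>carrier V. map1 f' (\<theta> x) \<oplus>\<^bsub>Y\<^esub> \<tau> (map1 g x))"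
    if "V \<in> Ob" "W \<in> Ob" "Y \<in> Ob" "f \<in> Hom V W" "g \<in> Hom V W" "f' \<in> Hom W Y" "g' \<in> Hom W Y"
      "\<theta> \<in> Cell V W f g" "\<tau> \<in> Cell W Y f' g'" for V W Y f g f' g' \<theta> \<tau>
    by (rule leibniz_hcomposable.homotopy_hcomp_eq[OF hcomp[OF that]])
  ultimately show ?thesis
    unfolding Ob_def Hom_def Cell_def by simp
qed

end
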